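(* Let $\theta\in(0,1)$, let $X_1,X_2,\ldots$ be i.i.d. random variables uniformly distributed on $[0,1]$, let $N=\inf\{n\ge 1: X_n<\theta\}$, and, on the event $\{N\ge 2\}$, let $$Z=\min_{1\le i\le N-1}X_i .$$ Then, conditionally on the event $\{N\ge2\}$, the random variable $Z$ has probability density function $$g(z)=\frac{\theta}{(1-\theta)z^2},\qquad \theta\le z\le 1,$$ and $g(z)=0$ for $z\notin[\theta,1]$.
   Context: This is the Correlated Standard Uniform Geometric (CSUG) model for the minimum: uniform trials are conducted until one falls below $\theta$, and one takes the minimum of the trials preceding that one. Conditionally on $N\ge 2$, $N$ has probability mass function $\mathbb P(N=n\mid N\ge 2)=\theta(1-\theta)^{n-2}$, $n=2,3,\ldots$. Densities are with respect to Lebesgue measure. *)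

theory Defs
  imports "HOL-Probability.Probability"
begin

(* Trials are indexed from 1; X 0 is never used. The stopping time is extended-valued,
   so that the infimum of the empty set is infinity. *)
definition csug_N :: "real \<Rightarrow> (nat \<Rightarrow> 'a \<Rightarrow> real) \<Rightarrow> 'a \<Rightarrow> enat" where
  "csug_N \<theta> X \<omega> = Inf (enat ` {n. 1 \<le> n \<and> X n \<omega> < \<theta>})"

(* The value 0 is a dummy, making the function total: it is used off the event N >= 2, where
   the minimum is over the empty set, and when N is infinite, which is a null event. *)
definition csug_Z :: "real \<Rightarrow> (nat \<Rightarrow> 'a \<Rightarrow> real) \<Rightarrow> 'a \<Rightarrow> real" where
  "csug_Z \<theta> X \<omega> =
     (case csug_N \<theta> X \<omega> of
        enat n \<Rightarrow> if 2 \<le> n then (MIN i\<in>{1..n - 1}. X i \<omega>) else 0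
      | \<infinity> \<Rightarrow> 0)"

(* uniform_measure M E is the measure A |-> M(E Int A) / M(E), which for a probability
   space M is the conditional probability given E; nothing uniform is meant here. *)
abbreviation cond_measure :: "'a measure \<Rightarrow> 'a set \<Rightarrow> 'a measure" where
  "cond_measure M E \<equiv> uniform_measure M E"

end

theory Submission
  imports Defs
begin

text \<open>For \<open>\<theta> \<le> a \<le> 1\<close> the event \<open>Z > a\<close>, which the dummy value \<open>0\<close> of \<open>Z\<close>
  confines to \<open>2 \<le> N < \<infinity>\<close>, is the disjoint union over \<open>n \<ge> 1\<close> of the events
  \<open>X 1, \<dots>, X n > a, X (n + 1) < \<theta>\<close>. Independence and the geometric series give it
  probability \<open>\<theta> (1 - a) / a\<close>. At \<open>a = \<theta>\<close> this is \<open>1 - \<theta>\<close>, the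
  probability of \<open>N \<ge> 2\<close>, so that no mass lies below \<open>\<theta>\<close>, nor above \<open>1\<close>.\<close>

text \<open>Replaces the infimum in \<open>enat\<close> by finitely many comparisons of trials. The
  successor form loses nothing: indices start at 1, so the infimum is never 0.\<close>

lemma csug_N_eq_Suc_iff:
  "csug_N \<theta> X \<omega> = enat (Suc n) \<longleftrightarrow>
     X (Suc n) \<omega> < \<theta> \<and> (\<forall>i\<in>{1..n}. \<theta> \<le> X i \<omega>)"
proof
  let ?S = "{n. 1 \<le> n \<and> X n \<omega> < \<theta>}"
  assume N: "csug_N \<theta> X \<omega> = enat (Suc n)"
  have "?S \<noteq> {}"
  proof
    assume "?S = {}"
    then have "csug_N \<theta> X \<omega> = \<infinity>"
      unfolding csug_N_def by (metis Inf_empty image_empty top_enat_def)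
    with N show False by simp
  qed
  then have "Inf (enat ` ?S) \<in> enat ` ?S"
    by (blast intro: wellorder_InfI)
  then have "Suc n \<in> ?S" using N unfolding csug_N_def by auto
  moreover have "\<theta> \<le> X i \<omega>" if "i \<in> {1..n}" for i
  proof (rule ccontr)
    assume "\<not> \<theta> \<le> X i \<omega>"
    with that have "csug_N \<theta> X \<omega> \<le> enat i"
      unfolding csug_N_def by (intro Inf_lower) auto
    with N that show False by simp
  qed
  ultimately show "X (Suc n) \<omega> < \<theta> \<and> (\<forall>i\<in>{1..n}. \<theta> \<le> X i \<omega>)" by simp
next
  assume *: "X (Suc n) \<omega> < \<theta> \<and> (\<forall>i\<in>{1..n}. \<theta> \<le> X i \<omega>)"
  show "csug_N \<theta> X \<omega> = enat (Suc n)"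
    unfolding csug_N_def
  proof (rule Inf_eqI)
    fix y assume "y \<in> enat ` {n. 1 \<le> n \<and> X n \<omega> < \<theta>}"
    then obtain m where m: "y = enat m" "1 \<le> m" "X m \<omega> < \<theta>" by auto
    with * have "\<not> m \<le> n" by force
    with m show "enat (Suc n) \<le> y" by simp
  next
    fix y assume "\<And>i. i \<in> enat ` {n. 1 \<le> n \<and> X n \<omega> < \<theta>} \<Longrightarrow> y \<le> i"
    with * show "y \<le> enat (Suc n)" by auto
  qed
qed

lemma csug_N_ge_2_iff: "2 \<le> csug_N \<theta> X \<omega> \<longleftrightarrow> \<theta> \<le> X 1 \<omega>"
proof -
  have "2 \<le> csug_N \<theta> X \<omega> \<longleftrightarrow>
      csug_N \<theta> X \<omega> \<noteq> enat 0 \<and> csug_N \<theta> X \<omega> \<noteq> enat (Suc 0)"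
    by (cases "csug_N \<theta> X \<omega>") (auto simp: numeral_eq_enat)
  \<comment> \<open>With 0 excluded, N < 2 leaves only N = 1, that is
    \<open>X 1 \<omega> < \<theta>\<close>. An infinite N counts as N >= 2.\<close>
  moreover have "csug_N \<theta> X \<omega> \<ge> enat 1"
    unfolding csug_N_def by (intro Inf_greatest) auto
  then have "csug_N \<theta> X \<omega> \<noteq> enat 0"
    by auto
  ultimately show ?thesis
    by (auto simp: csug_N_eq_Suc_iff)
qed

lemma csug_Z_cases:
  obtains (finite) n where "csug_N \<theta> X \<omega> = enat (Suc (Suc n))"
      "csug_Z \<theta> X \<omega> = (MIN i\<in>{1..Suc n}. X i \<omega>)"
    | (degenerate) "\<And>n. csug_N \<theta> X \<omega> \<noteq> enat (Suc (Suc n))" "csug_Z \<theta> X \<omega> = 0"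
proof (cases "\<exists>n. csug_N \<theta> X \<omega> = enat (Suc (Suc n))")
  case True
  then obtain n where "csug_N \<theta> X \<omega> = enat (Suc (Suc n))" by auto
  then show ?thesis by (intro that(1)[of n]) (auto simp: csug_Z_def)
next
  case False
  then have "csug_Z \<theta> X \<omega> = 0"
    unfolding csug_Z_def
    by (auto split: enat.split) (metis Suc_le_D numeral_2_eq_2 Suc_le_mono)
  with False show ?thesis by (intro that(2)) auto
qed

text \<open>The right-hand side involves only countably many comparisons of single trials, so it
  yields both the measurability of Z and the splitting of the event Z > a by the value of N. The
  second disjunct is the dummy value 0, which exceeds a only when a < 0.\<close>

lemma less_csug_Z_iff:
  "a < csug_Z \<theta> X \<omega> \<longleftrightarrow>
     (\<exists>n. X (Suc (Suc n)) \<omega> < \<theta> \<and> (\<forall>i\<in>{1..Suc n}. \<theta> \<le> X i \<omega> \<and> a < X i \<omega>)) \<or>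
     (a < 0 \<and> \<not> (\<exists>n. X (Suc (Suc n)) \<omega> < \<theta> \<and> (\<forall>i\<in>{1..Suc n}. \<theta> \<le> X i \<omega>)))"
proof (cases rule: csug_Z_cases[of \<theta> X \<omega>])
  case (finite n)
  \<comment> \<open>The witness on the right is forced, being determined by the value of N; hence
    both existentials can be evaluated at n.\<close>
  have "m = n" if "X (Suc (Suc m)) \<omega> < \<theta> \<and> (\<forall>i\<in>{1..Suc m}. \<theta> \<le> X i \<omega>)" for m
    using that finite(1) unfolding csug_N_eq_Suc_iff[symmetric] by simp
  moreover have "a < csug_Z \<theta> X \<omega> \<longleftrightarrow> (\<forall>i\<in>{1..Suc n}. a < X i \<omega>)"
    unfolding finite(2) by (subst Min_gr_iff) auto
  ultimately show ?thesis
    using finite(1) unfolding csug_N_eq_Suc_iff by (smt (verit, best))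
next
  case degenerate
  then show ?thesis unfolding csug_N_eq_Suc_iff by auto
qed

lemma csug_Z_measurable:
  assumes [measurable]: "\<And>n. 1 \<le> n \<Longrightarrow> X n \<in> borel_measurable M"
  shows "csug_Z \<theta> X \<in> borel_measurable M"
proof -
  have [measurable]: "X (Suc n) \<in> borel_measurable M" for n by simp
  have "{\<omega> \<in> space M. a < csug_Z \<theta> X \<omega>} \<in> sets M" for a
    unfolding less_csug_Z_iff by measurable
  then show ?thesis by (simp add: borel_measurable_iff_greater)
qed

context prob_space
begin

text \<open>The set S is a separate parameter so that each use can supply an explicit subinterval of
  [0,1] whose length the simplifier computes.\<close>

lemma prob_uniform:
  fixes Y :: "'a \<Rightarrow> real"
  assumes "distributed M lborel Y (indicator {0..1})" and "A \<in> sets borel"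
    and "A \<inter> {0..1} = S" and "emeasure lborel S = ennreal c" and "0 \<le> c"
  shows "prob (Y -` A \<inter> space M) = c"
proof -
  have "S \<in> sets borel"
    unfolding assms(3)[symmetric] using assms(2) by (intro sets.Int) auto
  have "emeasure M (Y -` A \<inter> space M) = (\<integral>\<^sup>+x. indicator {0..1} x * indicator A x \<partial>lborel)"
    using assms by (intro distributed_emeasure) auto
  also have "\<dots> = (\<integral>\<^sup>+x. indicator S x \<partial>lborel)"
    using assms(3) by (intro nn_integral_cong) (auto simp: indicator_def)
  also have "\<dots> = ennreal c"
    using \<open>S \<in> sets borel\<close> assms(4) by (subst nn_integral_indicator) auto
  finally show ?thesis using assms(5) by (simp add: measure_eq_emeasure_eq_ennreal)
qed

lemma prob_less_csug_Z:
  assumes indep: "indep_vars (\<lambda>_. borel) X {1..}"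
    and unif: "\<And>n. 1 \<le> n \<Longrightarrow> distributed M lborel (X n) (indicator {0..1})"
    and "0 < \<theta>" "\<theta> \<le> a" "a \<le> 1"
  shows "prob {\<omega> \<in> space M. a < csug_Z \<theta> X \<omega>} = \<theta> * (1 / a - 1)"
proof -
  \<comment> \<open>The part of Z > a on which N = n + 2. Since \<open>\<theta> \<le> a\<close>, the
    bound \<open>a < X i \<omega>\<close> already implies
    \<open>\<theta> \<le> X i \<omega>\<close>.\<close>
  define E where "E n = {\<omega> \<in> space M. X (Suc (Suc n)) \<omega> < \<theta> \<and> (\<forall>i\<in>{1..Suc n}. a < X i \<omega>)}" for n
  have [measurable]: "X i \<in> borel_measurable M" if "1 \<le> i" for i
    using unif[OF that] by (simp add: distributed_def)
  have [measurable]: "X (Suc i) \<in> borel_measurable M" for i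
    by simp
  have tail: "prob (X i -` {a<..} \<inter> space M) = 1 - a" if "1 \<le> i" for i
    using assms by (intro prob_uniform[OF unif[OF that], where S = "{a<..1}"]) auto
  have head: "prob (X i -` {..<\<theta>} \<inter> space M) = \<theta>" if "1 \<le> i" for i
    using assms by (intro prob_uniform[OF unif[OF that], where S = "{0..<\<theta>}"]) auto
  have "prob (E n) = \<theta> * (1 - a) * (1 - a) ^ n" for n
  proof -
    \<comment> \<open>One set per trial index turns \<open>E n\<close> into a finite intersection of
      preimages, the shape to which independence applies.\<close>
    define B where "B i = (if i \<le> Suc n then {a<..} else {..<\<theta>})" for i
    have ins: "{1..Suc (Suc n)} = insert (Suc (Suc n)) {1..Suc n}"
      by auto
    have "E n = (\<Inter>i\<in>{1..Suc (Suc n)}. X i -` B i \<inter> space M)"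
      unfolding ins E_def B_def by auto
    also have "prob \<dots> = (\<Prod>i\<in>{1..Suc (Suc n)}. prob (X i -` B i \<inter> space M))"
      by (intro indep_varsD[OF indep]) (auto simp: B_def)
    also have "\<dots> = (\<Prod>i\<in>{1..Suc n}. 1 - a) * \<theta>"
      unfolding ins by (simp add: B_def tail head)
    finally show ?thesis by simp
  qed
  moreover have "(\<lambda>n. prob (E n)) sums prob (\<Union>n. E n)"
  proof (rule finite_measure_UNION)
    show "disjoint_family E"
      unfolding disjoint_family_on_def
    proof (intro ballI impI)
      fix m n :: nat assume "m \<noteq> n"
      have "enat (Suc (Suc k)) = csug_N \<theta> X \<omega>" if "\<omega> \<in> E k" for k \<omega>
        using that assms by (subst eq_commute) (force simp: csug_N_eq_Suc_iff E_def)
      with \<open>m \<noteq> n\<close> show "E m \<inter> E n = {}"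
        by (metis disjoint_iff enat.inject old.nat.inject)
    qed
    have "E n \<in> events" for n
      unfolding E_def by measurable
    then show "range E \<subseteq> events" by auto
  qed
  moreover have "(\<lambda>n. \<theta> * (1 - a) * (1 - a) ^ n) sums (\<theta> * (1 - a) * (1 / (1 - (1 - a))))"
    using assms by (intro sums_mult geometric_sums) auto
  ultimately have "prob (\<Union>n. E n) = \<theta> * (1 - a) * (1 / (1 - (1 - a)))"
    by (metis (no_types, lifting) sums_cong sums_unique2)
  \<comment> \<open>The dummy disjunct of \<open>less_csug_Z_iff\<close> is impossible here because
    a > 0.\<close>
  moreover have "{\<omega> \<in> space M. a < csug_Z \<theta> X \<omega>} = (\<Union>n. E n)"
    using assms unfolding less_csug_Z_iff E_def by (auto 4 3)
  ultimately show ?thesis using assms by (simp add: field_simps)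
qed

lemma prob_csug_N_ge_2:
  assumes "distributed M lborel (X 1) (indicator {0..1})" and "0 < \<theta>" "\<theta> < 1"
  shows "prob {\<omega> \<in> space M. 2 \<le> csug_N \<theta> X \<omega>} = 1 - \<theta>"
proof -
  have "{\<omega> \<in> space M. 2 \<le> csug_N \<theta> X \<omega>} = X 1 -` {\<theta>..} \<inter> space M"
    by (auto simp: csug_N_ge_2_iff)
  moreover have "prob (X 1 -` {\<theta>..} \<inter> space M) = 1 - \<theta>"
    using assms by (intro prob_uniform[OF assms(1), where S = "{\<theta>..1}"]) auto
  ultimately show ?thesis by simp
qed

end

text \<open>The distribution function of the claimed density. Clamping a to [\<theta>, 1] covers all
  ranges by one formula: it gives 0 for a < \<theta> and 1 for a > 1.\<close>

lemma nn_integral_csug_density: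
  fixes \<theta> a :: real
  assumes "0 < \<theta>" "\<theta> < 1"
  shows "(\<integral>\<^sup>+z. ennreal ((if \<theta> \<le> z \<and> z \<le> 1 then \<theta> / ((1 - \<theta>) * z\<^sup>2) else 0) * indicator {..a} z) \<partial>lborel)
    = ennreal ((1 - \<theta> / max \<theta> (min a 1)) / (1 - \<theta>))"
proof (cases "a < \<theta>")
  case True
  then have "(\<integral>\<^sup>+z. ennreal ((if \<theta> \<le> z \<and> z \<le> 1 then \<theta> / ((1 - \<theta>) * z\<^sup>2) else 0) * indicator {..a} z) \<partial>lborel)
    = (\<integral>\<^sup>+z. 0 \<partial>(lborel :: real measure))"
    by (intro nn_integral_cong) (auto simp: indicator_def)
  with True assms show ?thesis by (simp add: max_def min_def)
next
  case False
  define c where "c = min a 1"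
  have c: "\<theta> \<le> c" using False assms by (simp add: c_def)
  have "(\<integral>\<^sup>+z. ennreal ((if \<theta> \<le> z \<and> z \<le> 1 then \<theta> / ((1 - \<theta>) * z\<^sup>2) else 0) * indicator {..a} z) \<partial>lborel)
    = (\<integral>\<^sup>+z. ennreal (\<theta> / ((1 - \<theta>) * z\<^sup>2)) * indicator {\<theta>..c} z \<partial>lborel)"
    by (intro nn_integral_cong) (auto simp: indicator_def c_def)
  also have "\<dots> = ennreal (- \<theta> / ((1 - \<theta>) * c) - - \<theta> / ((1 - \<theta>) * \<theta>))"
  proof (rule nn_integral_FTC_Icc)
    show "((\<lambda>z. - \<theta> / ((1 - \<theta>) * z)) has_real_derivative \<theta> / ((1 - \<theta>) * z\<^sup>2)) (at z)"
      if "z \<in> {\<theta>..c}" for z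
      using that assms
      by (auto intro!: derivative_eq_intros simp: power2_eq_square divide_simps)
  qed (use assms c in auto)
  also have "- \<theta> / ((1 - \<theta>) * c) - - \<theta> / ((1 - \<theta>) * \<theta>) = (1 - \<theta> / c) / (1 - \<theta>)"
    using assms c by (simp add: divide_simps)
  finally show ?thesis using c by (simp add: c_def max_absorb2)
qed

theorem proposition3p2:
  fixes M :: "'a measure" and X :: "nat \<Rightarrow> 'a \<Rightarrow> real" and \<theta> :: real
  assumes "prob_space M"
    and "0 < \<theta>" and "\<theta> < 1"
    and "prob_space.indep_vars M (\<lambda>_. borel) X {1..}"
    and "\<And>n. 1 \<le> n \<Longrightarrow> distributed M lborel (X n) (indicator {0..1})"
  shows "distributed
    (cond_measure M {\<omega> \<in> space M. 2 \<le> csug_N \<theta> X \<omega>}) lborel (csug_Z \<theta> X)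
    (\<lambda>z. ennreal (if \<theta> \<le> z \<and> z \<le> 1 then \<theta> / ((1 - \<theta>) * z\<^sup>2) else 0))"
proof -
  interpret prob_space M by fact
  define A where "A = {\<omega> \<in> space M. 2 \<le> csug_N \<theta> X \<omega>}"
  define B where "B a = {\<omega> \<in> space M. a < csug_Z \<theta> X \<omega>}" for a
  have X: "X n \<in> borel_measurable M" if "1 \<le> n" for n
    using assms(5)[OF that] by (simp add: distributed_def)
  have [measurable]: "X (Suc 0) \<in> borel_measurable M"
    using X[of 1] by simp
  have [measurable]: "csug_Z \<theta> X \<in> borel_measurable M"
    using X by (rule csug_Z_measurable)
  have [measurable]: "A \<in> events"
    unfolding A_def csug_N_ge_2_iff by simp
  have [measurable]: "B a \<in> events" for a
    unfolding B_def by measurable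
  have prob_A: "prob A = 1 - \<theta>"
    unfolding A_def using assms by (intro prob_csug_N_ge_2) auto
  have prob_B: "prob (B a) = \<theta> * (1 / a - 1)" if "\<theta> \<le> a" "a \<le> 1" for a
    unfolding B_def using assms that by (intro prob_less_csug_Z) auto
  have B_subset_A: "B a \<subseteq> A" if "\<theta> \<le> a" for a
    using that assms(2) unfolding A_def B_def csug_N_ge_2_iff less_csug_Z_iff by fastforce
  have B_antimono: "B b \<subseteq> B a" if "a \<le> b" for a b
    using that by (auto simp: B_def)
  \<comment> \<open>Let c be a clamped to [\<theta>, 1]. For a < \<theta> the event lies between
    \<open>B \<theta>\<close> and \<open>A\<close>, which have equal probability; this also disposes
    of the dummy value when N is infinite. For a > 1 it lies in \<open>B 1\<close>, which is null.
    In between it is \<open>B a\<close> itself.\<close>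
  have prob_AB: "prob (A \<inter> B a) = \<theta> * (1 / max \<theta> (min a 1) - 1)" for a
  proof (rule antisym)
    define c where "c = max \<theta> (min a 1)"
    have c: "\<theta> \<le> c" "c \<le> 1" using assms by (auto simp: c_def)
    show "prob (A \<inter> B a) \<le> \<theta> * (1 / c - 1)"
    proof (cases "a < \<theta>")
      case True
      have "prob (A \<inter> B a) \<le> prob A" by (intro finite_measure_mono) auto
      with True assms show ?thesis by (simp add: prob_A c_def right_diff_distrib)
    next
      case False
      then have "prob (A \<inter> B a) \<le> prob (B c)"
        using B_antimono[of c a] by (intro finite_measure_mono) (auto simp: c_def)
      then show ?thesis by (simp add: prob_B c)
    qed
    show "\<theta> * (1 / c - 1) \<le> prob (A \<inter> B a)"
    proof (cases "a \<le> 1")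
      case True
      then have "prob (B c) \<le> prob (A \<inter> B a)"
        using B_subset_A[OF c(1)] B_antimono[of a c]
        by (intro finite_measure_mono) (auto simp: c_def)
      then show ?thesis by (simp add: prob_B c)
    qed (use assms in \<open>simp add: c_def\<close>)
  qed
  show ?thesis
    unfolding A_def[symmetric]
  \<comment> \<open>The half-lines \<open>{..a}\<close> determine the law, so it is enough that both
    distribution functions equal the same clamped expression.\<close>
  proof (rule distributedI_borel_atMost)
    show "(\<integral>\<^sup>+z. ennreal ((if \<theta> \<le> z \<and> z \<le> 1 then \<theta> / ((1 - \<theta>) * z\<^sup>2) else 0) * indicator {..a} z) \<partial>lborel)
      = ennreal ((1 - \<theta> / max \<theta> (min a 1)) / (1 - \<theta>))" for a
      by (rule nn_integral_csug_density[OF assms(2,3)])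
    fix a
    have "A \<inter> {\<omega> \<in> space M. csug_Z \<theta> X \<omega> \<le> a} = A - A \<inter> B a"
      by (auto simp: A_def B_def)
    \<comment> \<open>With c the clamped a, this is (1 - \<theta>) - \<theta> (1/c - 1) = 1 -
      \<theta>/c; conditioning then divides by \<open>prob A\<close>, which is 1 - \<theta>.\<close>
    then have "prob (A \<inter> {\<omega> \<in> space M. csug_Z \<theta> X \<omega> \<le> a}) = 1 - \<theta> / max \<theta> (min a 1)"
      by (simp add: finite_measure_Diff prob_A prob_AB algebra_simps)
    then show "emeasure (uniform_measure M A) {\<omega> \<in> space (uniform_measure M A). csug_Z \<theta> X \<omega> \<le> a}
      = ennreal ((1 - \<theta> / max \<theta> (min a 1)) / (1 - \<theta>))"
      using assms by (simp add: emeasure_eq_measure prob_A divide_ennreal)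
  qed (use assms in auto)
qed

end
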